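(* Let $A_1A_2A_3A_4$ be a tetrahedron in the three-dimensional $K$-space, let $\kappa=\sqrt K$, and let $A_0$ be the corresponding weighted Fermat point inside the tetrahedron. The geodesic edges $a_{03}$ and $a_{04}$ can be expressed as functions of $a_{01},a_{02},\alpha$: $$\cos\kappa a_{03}=\cos\kappa a_{02}\cos\kappa a_{23}+\sin\kappa a_{23}\cos\kappa h_{0,12}\cos\alpha_{123}\sin\kappa l(a_{01},a_{02})+\sin\kappa a_{23}\sin\alpha_{123}\cos\alpha,$$ $$\cos\kappa a_{04}=\cos\kappa a_{02}\cos\kappa a_{24}+\sin\kappa a_{24}\cos\kappa h_{0,12}\cos\alpha_{124}\sin\kappa l(a_{01},a_{02})+\sin\kappa a_{24}\sin\alpha_{124}\cos(\alpha_{g_4}-\alpha).$$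
   Context: The three-dimensional $K$-space is $\mathbb{R}^3$ if $K=0$, the open hemisphere of the 3-sphere of radius $\frac1{\sqrt K}$ if $K>0$, and the Lobachevsky space of constant curvature $K$ if $K<0$ (where $\kappa$ is imaginary, so that $\cos\kappa x=\cosh(\sqrt{|K|}\,x)$). The weighted Fermat point for positive weights $B_1,\dots,B_4$ is the point minimizing $\sum_iB_i\,d(X,A_i)$ ($d$ the geodesic distance). Notation: $a_{ij}$ is the length of the geodesic arc $A_iA_j$; $\alpha_{ijk}=\angle A_iA_jA_k$; $\alpha$ is the dihedral angle formed by the planes of $\triangle A_1A_2A_3$ and $\triangle A_1A_2A_0$; $\alpha_{g_4}$ is the dihedral angle formed by the planes of $\triangle A_1A_2A_3$ and $\triangle A_1A_2A_4$; $A_{0,12}$ is the projection of $A_0$ to $A_1A_2$; $h_{0,12}$ is the length of $A_0A_{0,12}$, i.e. the height of $\triangle A_0A_1A_2$ from $A_0$ to $A_1A_2$; $l$ is the length of $A_{0,12}A_2$. The quantities $h_{0,12}$ and $l$ are functions of $a_{01},a_{02}$ (and $a_{12}$) through $$\sin\kappa h_{0,12}=\frac{\sin\kappa a_{01}\sin\kappa a_{02}}{\sin\kappa a_{12}}\sqrt{1-\left(\frac{\cos\kappa a_{12}-\cos\kappa a_{01}\cos\kappa a_{02}}{\sin\kappa a_{01}\sin\kappa a_{02}}\right)^2},\qquad \cos\kappa l=\frac{\cos\kappa a_{02}}{\cos\kappa h_{0,12}}.$$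
   Formalization: The last term of both formulas carries the factor sin κh_{0,12} missing in print (without it they fail, e.g. for the centre of a small regular tetrahedron), and l is taken negative when the projection A_{0,12} lies beyond A_2, where the unsigned length fails. *)

theory Defs
  imports "HOL-Analysis.Analysis"
begin

text \<open>
  All three geometries are realised inside the four-dimensional space \<open>real \<times> real^3\<close>.
  For \<open>K = 0\<close> the space is placed at height 1, so that in each case the lines, the planes and the
  tetrahedra are the intersections of the space with linear subspaces and with simplicial
  convex cones.
\<close>

type_synonym kpoint = "real \<times> (real^3)"

text \<open>The ambient form; restricted to tangent vectors of the \<open>K\<close>-space it is the Riemannian metric.\<close>

definition kform :: "real \<Rightarrow> kpoint \<Rightarrow> kpoint \<Rightarrow> real" where
  "kform K x y = (if K < 0 then - (fst x * fst y) else fst x * fst y) + snd x \<bullet> snd y"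

text \<open>
  Open hemisphere of the sphere of radius \<open>1 / sqrt K\<close>, Euclidean space, and one sheet of the
  hyperboloid, respectively.
\<close>

definition kspace :: "real \<Rightarrow> kpoint set" where
  "kspace K =
     (if K > 0 then {x. norm x = 1 / sqrt K \<and> fst x > 0}
      else if K = 0 then {x. fst x = 1}
      else {x. kform K x x = 1 / K \<and> fst x > 0})"

text \<open>Geodesic distance.\<close>

definition kdist :: "real \<Rightarrow> kpoint \<Rightarrow> kpoint \<Rightarrow> real" where
  "kdist K x y =
     (if K > 0 then arccos (K * kform K x y) / sqrt K
      else if K = 0 then dist x y
      else arcosh (K * kform K x y) / sqrt (- K))"

text \<open>
  A tangent vector at \<open>P\<close> pointing along the geodesic from \<open>P\<close> to \<open>X\<close>: the form-orthogonal projection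
  of \<open>X\<close> to the tangent space at \<open>P\<close> (recall that \<open>kform K P P = 1 / K\<close> for \<open>K \<noteq> 0\<close>).
  It is not normalised, and it vanishes iff \<open>X = P\<close>.
\<close>

definition kdir :: "real \<Rightarrow> kpoint \<Rightarrow> kpoint \<Rightarrow> kpoint" where
  "kdir K P X = X - (if K = 0 then 1 else K * kform K P X) *\<^sub>R P"

definition kvangle :: "real \<Rightarrow> kpoint \<Rightarrow> kpoint \<Rightarrow> real" where
  "kvangle K u v = arccos (kform K u v / (sqrt (kform K u u) * sqrt (kform K v v)))"

text \<open>The angle \<open>X P Y\<close> with vertex \<open>P\<close>.\<close>

definition kangle :: "real \<Rightarrow> kpoint \<Rightarrow> kpoint \<Rightarrow> kpoint \<Rightarrow> real" where
  "kangle K X P Y = kvangle K (kdir K P X) (kdir K P Y)"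

definition kperp :: "real \<Rightarrow> kpoint \<Rightarrow> kpoint \<Rightarrow> kpoint" where
  "kperp K u v = v - (kform K v u / kform K u u) *\<^sub>R u"

text \<open>
  The dihedral angle, in \<open>[0, pi]\<close>, between the half-planes bounded by the line \<open>P Q\<close> that contain
  \<open>X\<close> and \<open>Y\<close>, measured at the point \<open>Q\<close> of the edge between the directions in the two half-planes
  that are perpendicular to the edge.
\<close>

definition kdihedral :: "real \<Rightarrow> kpoint \<Rightarrow> kpoint \<Rightarrow> kpoint \<Rightarrow> kpoint \<Rightarrow> real" where
  "kdihedral K P Q X Y =
     kvangle K (kperp K (kdir K Q P) (kdir K Q X)) (kperp K (kdir K Q P) (kdir K Q Y))"

definition kline :: "real \<Rightarrow> kpoint \<Rightarrow> kpoint \<Rightarrow> kpoint set" where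
  "kline K P Q = kspace K \<inter> span {P, Q}"

text \<open>\<open>F\<close> is the (orthogonal) projection of \<open>X\<close> to the geodesic \<open>P Q\<close>.\<close>

definition is_kfoot :: "real \<Rightarrow> kpoint \<Rightarrow> kpoint \<Rightarrow> kpoint \<Rightarrow> kpoint \<Rightarrow> bool" where
  "is_kfoot K P Q X F \<longleftrightarrow>
     F \<in> kline K P Q \<and> (\<forall>Z\<in>kline K P Q. kform K (kdir K F X) (kdir K F Z) = 0)"

text \<open>
  The length of the arc \<open>Q F\<close> of the line \<open>P Q\<close>, counted negatively when \<open>Q\<close> separates \<open>F\<close> from \<open>P\<close>.
  When \<open>F\<close> lies on the arc \<open>P Q\<close> this is just the length; the sign is needed because the
  projection of an interior point of a tetrahedron may fall outside the edge.
\<close>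

definition kolen :: "real \<Rightarrow> kpoint \<Rightarrow> kpoint \<Rightarrow> kpoint \<Rightarrow> real" where
  "kolen K P Q F =
     (if 0 \<le> kform K (kdir K Q P) (kdir K Q F) then kdist K F Q else - kdist K F Q)"

text \<open>Four vertices that do not lie in a common plane of the \<open>K\<close>-space.\<close>

definition ktetrahedron :: "real \<Rightarrow> (nat \<Rightarrow> kpoint) \<Rightarrow> bool" where
  "ktetrahedron K A \<longleftrightarrow>
     (\<forall>i\<in>{1..4}. A i \<in> kspace K) \<and> inj_on A {1..4} \<and> independent (A ` {1..4})"

definition kinside :: "real \<Rightarrow> (nat \<Rightarrow> kpoint) \<Rightarrow> kpoint set" where
  "kinside K A =
     {X \<in> kspace K. \<exists>c. (\<forall>i\<in>{1..4}. 0 < c i) \<and> X = (\<Sum>i\<in>{1..4}. c i *\<^sub>R A i)}"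

definition is_weighted_Fermat_point ::
    "real \<Rightarrow> (nat \<Rightarrow> kpoint) \<Rightarrow> (nat \<Rightarrow> real) \<Rightarrow> kpoint \<Rightarrow> bool" where
  "is_weighted_Fermat_point K A B X \<longleftrightarrow>
     is_arg_min (\<lambda>Y. \<Sum>i\<in>{1..4}. B i * kdist K Y (A i)) (\<lambda>Y. Y \<in> kspace K) X"

end

theory Submission imports Defs begin

text \<open>
  For \<open>K \<noteq> 0\<close> write \<open>b = kform K\<close> and \<open>|v| = sqrt (b v v)\<close>. Then, uniformly in the sign of \<open>K\<close>,
  \<open>cos (\<kappa> d(P,X)) = K b(P,X)\<close> and \<open>sin (\<kappa> d(P,X)) = \<kappa> |kdir P X|\<close>, so that every
  trigonometric expression becomes an expression in the form \<open>b\<close>. The defining property of the foot \<open>F\<close>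
  says that \<open>A\<^sub>0 = K b(F,A\<^sub>0) F + g\<close> with \<open>g\<close> orthogonal to the plane spanned by \<open>A\<^sub>1, A\<^sub>2\<close>, whence \<open>g\<close> is
  the component of \<open>A\<^sub>0\<close> used in the dihedral angle. The formulas result from
  expanding \<open>b(A\<^sub>0,A\<^sub>3)\<close> and \<open>b(A\<^sub>0,A\<^sub>4)\<close> along \<open>A\<^sub>2\<close>, the direction to \<open>A\<^sub>1\<close>, and the orthogonal
  complement of both. As \<open>A\<^sub>0\<close> is inside the tetrahedron, \<open>g\<close> is a positive combination of the
  components of \<open>A\<^sub>3\<close> and \<open>A\<^sub>4\<close>, which yields additivity of the dihedral angles.
  For \<open>K = 0\<close> all assertions degenerate to \<open>1 = 1\<close>.
\<close>

section \<open>The ambient form and the length of tangent vectors\<close>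

text \<open>A norm on tangent spaces only: for \<open>K < 0\<close> the ambient form is
  indefinite.\<close>

definition knorm :: "real \<Rightarrow> kpoint \<Rightarrow> real" where
  "knorm K v = sqrt (kform K v v)"

lemma kform_commute: "kform K x y = kform K y x"
  by (simp add: kform_def inner_commute mult.commute)

lemma kform_add_left: "kform K (x + y) z = kform K x z + kform K y z"
  by (simp add: kform_def inner_add_left algebra_simps)

lemma kform_scale_left: "kform K (c *\<^sub>R x) z = c * kform K x z"
  by (simp add: kform_def algebra_simps)

lemma kform_diff_left: "kform K (x - y) z = kform K x z - kform K y z"
  by (simp add: kform_def inner_diff_left algebra_simps)

lemma kform_add_right: "kform K z (x + y) = kform K z x + kform K z y"
  by (simp add: kform_def inner_add_right algebra_simps)

lemma kform_scale_right: "kform K z (c *\<^sub>R x) = c * kform K z x"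
  by (simp add: kform_def algebra_simps)

lemma kform_diff_right: "kform K z (x - y) = kform K z x - kform K z y"
  by (simp add: kform_def inner_diff_right algebra_simps)

lemmas kform_linear =
  kform_add_left kform_scale_left kform_diff_left
  kform_add_right kform_scale_right kform_diff_right

lemma kform_zero_left [simp]: "kform K 0 x = 0"
  by (simp add: kform_def)

section \<open>Tangent spaces and the range of the form on pairs of points\<close>

lemma kspace_kform_self:
  assumes "K \<noteq> 0" "P \<in> kspace K"
  shows "kform K P P = 1 / K"
proof (cases "K > 0")
  case True
  then have "P \<bullet> P = (1 / sqrt K)\<^sup>2"
    using assms by (simp add: kspace_def power2_norm_eq_inner [symmetric])
  then show ?thesis
    using True by (simp add: kform_def inner_prod_def power_divide)
qed (use assms in \<open>auto simp: kspace_def\<close>)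

text \<open>For \<open>K > 0\<close> the form is the Euclidean inner product. For
  \<open>K < 0\<close> tangency reads \<open>s * p = w \<bullet> q\<close>, and Cauchy-Schwarz
  together with \<open>q \<bullet> q < p * p\<close> bounds the time component \<open>s\<close> by
  the space component \<open>w\<close>.\<close>

lemma kform_pos_tangent:
  assumes "K \<noteq> 0" "P \<in> kspace K" "kform K v P = 0" "v \<noteq> 0"
  shows "kform K v v > 0"
proof (cases "K > 0")
  case True
  then have "kform K v v = v \<bullet> v"
    by (simp add: kform_def inner_prod_def)
  then show ?thesis
    using assms by simp
next
  case False
  then have K: "K < 0"
    using assms by simp
  obtain p q where P: "P = (p, q)" by fastforce
  obtain s w where v: "v = (s, w)" by fastforce
  have sp: "s * p = w \<bullet> q" and p2: "q \<bullet> q = p * p + 1 / K" and p: "p > 0"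
    using assms K kspace_kform_self [of K P] by (auto simp: kform_def P v kspace_def)
  have "w \<noteq> 0"
    using sp p assms(4) by (auto simp: v zero_prod_def)
  then have ww: "w \<bullet> w > 0" by simp
  have "(s * p)\<^sup>2 \<le> (w \<bullet> w) * (q \<bullet> q)"
    unfolding sp by (rule Cauchy_Schwarz_ineq)
  also have "\<dots> < (w \<bullet> w) * p\<^sup>2"
    using ww K by (simp add: p2 power2_eq_square)
  finally have "s\<^sup>2 * p\<^sup>2 < (w \<bullet> w) * p\<^sup>2"
    by (simp add: power_mult_distrib)
  then have "s\<^sup>2 < w \<bullet> w"
    using p by simp
  then show ?thesis
    using K by (simp add: kform_def v power2_eq_square)
qed

lemma kform_nonneg_tangent:
  assumes "K \<noteq> 0" "P \<in> kspace K" "kform K v P = 0"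
  shows "kform K v v \<ge> 0"
  using kform_pos_tangent [OF assms] by (cases "v = 0") auto

lemma kform_kdir_base [simp]:
  assumes "K \<noteq> 0" "P \<in> kspace K"
  shows "kform K (kdir K P X) P = 0"
  using assms by (simp add: kdir_def kform_linear kspace_kform_self kform_commute)

text \<open>Multiplied by \<open>K\<close>, this is the law of cosines at \<open>P\<close> before
  normalisation.\<close>

lemma kform_kdir_kdir:
  assumes "K \<noteq> 0" "P \<in> kspace K"
  shows "kform K (kdir K P X) (kdir K P Y) = kform K X Y - K * kform K P X * kform K P Y"
  using assms by (simp add: kdir_def kform_linear kspace_kform_self kform_commute)

lemma kform_kdir_self:
  assumes "K \<noteq> 0" "P \<in> kspace K" "X \<in> kspace K"
  shows "K * kform K (kdir K P X) (kdir K P X) = 1 - (K * kform K P X)\<^sup>2"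
  using assms by (simp add: kform_kdir_kdir kspace_kform_self field_simps power2_eq_square)

lemma knorm_kdir_commute:
  assumes "K \<noteq> 0" "P \<in> kspace K" "X \<in> kspace K"
  shows "knorm K (kdir K P X) = knorm K (kdir K X P)"
  using assms by (simp add: knorm_def kform_kdir_kdir kspace_kform_self kform_commute)

lemma knorm_pos:
  assumes "K \<noteq> 0" "P \<in> kspace K" "kform K v P = 0" "v \<noteq> 0"
  shows "knorm K v > 0"
  using kform_pos_tangent [OF assms] by (simp add: knorm_def)

lemma knorm_square:
  assumes "K \<noteq> 0" "P \<in> kspace K" "kform K v P = 0"
  shows "(knorm K v)\<^sup>2 = kform K v v"
  using kform_nonneg_tangent [OF assms] by (simp add: knorm_def)

lemma kform_kspace_le_1:
  assumes "K > 0" "P \<in> kspace K" "X \<in> kspace K"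
  shows "\<bar>K * kform K P X\<bar> \<le> 1"
proof -
  have "K * kform K (kdir K P X) (kdir K P X) \<ge> 0"
    using assms kform_nonneg_tangent [of K P "kdir K P X"] by simp
  then show ?thesis
    using assms kform_kdir_self [of K P X] by (simp add: abs_square_le_1)
qed

text \<open>Positivity on the tangent space only bounds the square from below by 1. The sign comes
  from both points lying on the same sheet of the hyperboloid.\<close>

lemma kform_kspace_ge_1:
  assumes K: "K < 0" and P: "P \<in> kspace K" and X: "X \<in> kspace K"
  shows "K * kform K P X \<ge> 1"
proof -
  have pos: "K * kform K P X > 0"
  proof -
    \<comment> \<open>Points of the sheet lie strictly inside the forward cone, since
      \<open>1 / K\<close> is negative.\<close>
    have bound: "norm (snd Y) < fst Y" if "Y \<in> kspace K" for Y
    proof (rule power2_less_imp_less)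
      have "(norm (snd Y))\<^sup>2 - (fst Y)\<^sup>2 = 1 / K"
        unfolding power2_norm_eq_inner power2_eq_square [of "fst Y"]
        using that K by (simp add: kspace_def kform_def)
      then show "(norm (snd Y))\<^sup>2 < (fst Y)\<^sup>2"
        using K by (smt (verit) divide_neg_pos less_divide_eq_1_neg divide_less_0_iff)
      show "0 \<le> fst Y"
        using that K by (simp add: kspace_def)
    qed
    have "snd P \<bullet> snd X \<le> norm (snd P) * norm (snd X)"
      by (rule norm_cauchy_schwarz)
    also have "\<dots> < fst P * fst X"
      using bound [OF P] bound [OF X] by (intro mult_strict_mono') auto
    finally show ?thesis
      using K by (simp add: kform_def mult_neg_neg)
  qed
  have "K * kform K (kdir K P X) (kdir K P X) \<le> 0"
    using assms kform_nonneg_tangent [of K P "kdir K P X"] by (simp add: mult_nonpos_nonneg)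
  then have "1 \<le> (K * kform K P X)\<^sup>2"
    using assms kform_kdir_self [of K P X] by simp
  then show ?thesis
    using pos by (smt (verit) power2_eq_square mult_le_one mult_less_cancel_left2)
qed

section \<open>Cosine and sine of \<kappa> times the distance\<close>

lemma csqrt_real_neg: "K < 0 \<Longrightarrow> csqrt (of_real K) = \<i> * of_real (sqrt (- K))"
  by (auto simp: complex_eq_iff)

lemma exp_ii_times_ii_times_of_real:
  "exp (\<i> * (\<i> * of_real x)) = of_real (exp (- x))"
  "exp (- (\<i> * (\<i> * of_real x))) = of_real (exp x)"
  unfolding mult.assoc [symmetric] i_squared by (simp_all flip: exp_of_real)

lemma cos_ii_times_of_real: "cos (\<i> * of_real x) = of_real (cosh x)"
  unfolding cos_exp_eq exp_ii_times_ii_times_of_real by (simp add: cosh_def)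

lemma sin_ii_times_of_real: "sin (\<i> * of_real x) = \<i> * of_real (sinh x)"
  unfolding sin_exp_eq exp_ii_times_ii_times_of_real by (simp add: sinh_def field_simps)

lemma cos_kdist:
  assumes "K \<noteq> 0" "P \<in> kspace K" "X \<in> kspace K"
  shows "cos (csqrt (of_real K) * of_real (kdist K P X)) = of_real (K * kform K P X)"
proof (cases "K > 0")
  case True
  have "csqrt (of_real K) * of_real (kdist K P X) = of_real (arccos (K * kform K P X))"
    using True by (simp add: kdist_def)
  then show ?thesis
    using kform_kspace_le_1 [OF True assms(2,3)]
    by (simp only: cos_of_real) (simp add: cos_arccos_abs)
next
  case False
  then have K: "K < 0"
    using assms by simp
  have "csqrt (of_real K) * of_real (kdist K P X) = \<i> * of_real (arcosh (K * kform K P X))"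
    using K by (simp add: kdist_def csqrt_real_neg)
  then show ?thesis
    using kform_kspace_ge_1 [OF K assms(2,3)]
    by (simp add: cos_ii_times_of_real)
qed

text \<open>Sine squared is 1 minus cosine squared, which is \<open>K\<close> times the squared
  length of \<open>kdir K P X\<close>. The nonnegative root is the right one because
  \<open>arccos\<close> takes values in [0, pi] and \<open>arcosh\<close> takes nonnegative
  values.\<close>

lemma sin_kdist:
  assumes "K \<noteq> 0" "P \<in> kspace K" "X \<in> kspace K"
  shows "sin (csqrt (of_real K) * of_real (kdist K P X)) =
    csqrt (of_real K) * of_real (knorm K (kdir K P X))"
proof (cases "K > 0")
  case True
  have "csqrt (of_real K) * of_real (kdist K P X) = of_real (arccos (K * kform K P X))"
    using True by (simp add: kdist_def)
  moreover have "sin (arccos (K * kform K P X)) = sqrt K * knorm K (kdir K P X)"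
    using kform_kspace_le_1 [OF True assms(2,3)] kform_kdir_self [OF assms]
    by (simp add: sin_arccos_abs knorm_def real_sqrt_mult [symmetric])
  ultimately show ?thesis
    using True by (simp add: sin_of_real)
next
  case False
  then have K: "K < 0"
    using assms by simp
  have "csqrt (of_real K) * of_real (kdist K P X) = \<i> * of_real (arcosh (K * kform K P X))"
    using K by (simp add: kdist_def csqrt_real_neg)
  moreover have "sinh (arcosh (K * kform K P X)) = sqrt (- K) * knorm K (kdir K P X)"
    using kform_kspace_ge_1 [OF K assms(2,3)] kform_kdir_self [OF assms]
    by (simp add: sinh_arcosh_real knorm_def real_sqrt_mult [symmetric])
  ultimately show ?thesis
    using K by (simp only: sin_ii_times_of_real) (simp add: csqrt_real_neg)
qed

section \<open>Angles between tangent vectors\<close>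

lemma kform_kperp_kperp:
  assumes "kform K u u \<noteq> 0"
  shows "kform K (kperp K u v) (kperp K u w) =
    kform K v w - kform K u v * kform K u w / kform K u u"
  using assms by (simp add: kperp_def kform_linear kform_commute)

text \<open>The component of \<open>v\<close> perpendicular to \<open>u\<close> is again tangent at
  \<open>P\<close>, so its square is nonnegative even where the ambient form is indefinite.\<close>

lemma kform_Cauchy_Schwarz:
  assumes "K \<noteq> 0" "P \<in> kspace K" "kform K u P = 0" "kform K v P = 0"
  shows "(kform K u v)\<^sup>2 \<le> kform K u u * kform K v v"
proof (cases "u = 0")
  case False
  then have u: "kform K u u > 0"
    using assms kform_pos_tangent by blast
  have "kform K (kperp K u v) P = 0"
    using assms by (simp add: kperp_def kform_linear)
  then have "0 \<le> kform K (kperp K u v) (kperp K u v)"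
    using assms kform_nonneg_tangent by blast
  also have "\<dots> = kform K v v - (kform K u v)\<^sup>2 / kform K u u"
    using u by (simp add: kform_kperp_kperp power2_eq_square)
  finally show ?thesis
    using u by (simp add: field_simps)
qed simp

text \<open>The sine is stated as a product so that it is the root of the Gram determinant. Both
  equations also hold for zero vectors: division by 0 gives 0 and the angle is then
  \<open>arccos 0\<close>.\<close>

lemma
  assumes "K \<noteq> 0" "P \<in> kspace K" "kform K u P = 0" "kform K v P = 0"
  shows cos_kvangle: "cos (kvangle K u v) = kform K u v / (knorm K u * knorm K v)"
    and sin_kvangle: "knorm K u * knorm K v * sin (kvangle K u v) =
      sqrt (kform K u u * kform K v v - (kform K u v)\<^sup>2)"
proof -
  let ?c = "kform K u v / (knorm K u * knorm K v)"
  have cs: "(kform K u v)\<^sup>2 \<le> (knorm K u * knorm K v)\<^sup>2"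
    using kform_Cauchy_Schwarz [OF assms] assms by (simp add: power_mult_distrib knorm_square)
  have nonneg: "knorm K u \<ge> 0" "knorm K v \<ge> 0"
    using assms kform_nonneg_tangent by (auto simp: knorm_def)
  have "?c\<^sup>2 \<le> 1"
    using cs by (simp add: power_divide divide_le_eq_1) (smt (verit) zero_le_power2)
  then have c: "\<bar>?c\<bar> \<le> 1"
    by (simp only: abs_square_le_1)
  have ang: "kvangle K u v = arccos ?c"
    by (simp add: kvangle_def knorm_def)
  show "cos (kvangle K u v) = ?c"
    unfolding ang using c by (rule cos_arccos_abs)
  have "knorm K u * knorm K v * sqrt (1 - ?c\<^sup>2) = sqrt ((knorm K u * knorm K v)\<^sup>2 * (1 - ?c\<^sup>2))"
    using nonneg by (simp add: real_sqrt_mult)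
  also have "(knorm K u * knorm K v)\<^sup>2 * (1 - ?c\<^sup>2) = (knorm K u * knorm K v)\<^sup>2 - (kform K u v)\<^sup>2"
  \<comment> \<open>If a norm vanishes, \<open>cs\<close> forces
    \<open>kform K u v = 0\<close>.\<close>
  proof (cases "knorm K u * knorm K v = 0")
    case False
    then show ?thesis
      by (simp add: field_simps)
  qed (use cs in auto)
  also have "(knorm K u * knorm K v)\<^sup>2 = kform K u u * kform K v v"
    using assms by (simp add: power_mult_distrib knorm_square)
  finally show "knorm K u * knorm K v * sin (kvangle K u v) =
      sqrt (kform K u u * kform K v v - (kform K u v)\<^sup>2)"
    unfolding ang using c by (simp add: sin_arccos_abs)
qed

text \<open>The Gram determinant of \<open>u\<close> and \<open>v\<close>, divided by the square of
  \<open>u\<close>, is the square of the perpendicular component.\<close>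

lemma sin_kvangle_kperp:
  assumes "K \<noteq> 0" "P \<in> kspace K" "kform K u P = 0" "kform K v P = 0" "u \<noteq> 0"
  shows "knorm K v * sin (kvangle K u v) = knorm K (kperp K u v)"
proof -
  have u: "kform K u u > 0"
    using assms kform_pos_tangent by blast
  have "knorm K u * (knorm K v * sin (kvangle K u v)) =
      sqrt (kform K u u * (kform K v v - (kform K u v)\<^sup>2 / kform K u u))"
    using sin_kvangle [OF assms(1-4)] u by (simp add: field_simps)
  also have "\<dots> = knorm K u * knorm K (kperp K u v)"
    using u by (simp add: real_sqrt_mult knorm_def kform_kperp_kperp power2_eq_square)
  finally show ?thesis
    using u by (simp add: knorm_def)
qed

text \<open>As \<open>d\<close> is nonnegative, \<open>n\<close> and \<open>y\<close> lie on the
  same side of the line of \<open>x\<close>, so both angles are measured from \<open>x\<close> in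
  the same sense, and their difference is the angle between \<open>y\<close> and \<open>n\<close> up
  to sign. The coefficient \<open>c\<close> may have any sign.\<close>

lemma cos_kvangle_diff:
  assumes K: "K \<noteq> 0" "P \<in> kspace K" and "kform K x P = 0" "kform K y P = 0"
    and n: "n = c *\<^sub>R x + d *\<^sub>R y" and d: "d \<ge> 0"
    and x0: "x \<noteq> 0" and y0: "y \<noteq> 0" and n0: "n \<noteq> 0"
  shows "cos (kvangle K x y - kvangle K x n) = kform K y n / (knorm K y * knorm K n)"
proof -
  have tangent: "kform K x P = 0" "kform K y P = 0" "kform K n P = 0"
    using assms by (auto simp: kform_linear)
  define X Y N s t r where
    "X = knorm K x" "Y = knorm K y" "N = knorm K n"
    "s = kform K x y" "t = kform K x n" "r = kform K y n"
  note defs = this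
  have pos: "X > 0" "Y > 0" "N > 0"
    unfolding defs using assms tangent knorm_pos by blast+
  have sq: "kform K x x = X\<^sup>2" "kform K y y = Y\<^sup>2" "kform K n n = N\<^sup>2"
    unfolding defs using assms tangent knorm_square by metis+
  have t: "t = c * X\<^sup>2 + d * s"
    using n sq by (simp add: defs kform_linear)
  have r: "r = c * s + d * Y\<^sup>2"
    using n sq by (simp add: defs kform_linear kform_commute)
  have N: "N\<^sup>2 = c * t + d * r"
    unfolding sq [symmetric] by (subst n, simp only: kform_linear) (simp add: defs kform_commute)
  \<comment> \<open>Replacing \<open>y\<close> by \<open>c *\<^sub>R x + d *\<^sub>R y\<close>
    multiplies the Gram determinant with \<open>x\<close> by the square of \<open>d\<close>.\<close>
  have gram: "X\<^sup>2 * N\<^sup>2 - t\<^sup>2 = d\<^sup>2 * (X\<^sup>2 * Y\<^sup>2 - s\<^sup>2)"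
    unfolding N unfolding t r by (simp add: algebra_simps power2_eq_square)
  have cs: "0 \<le> X\<^sup>2 * Y\<^sup>2 - s\<^sup>2"
    using kform_Cauchy_Schwarz [OF K tangent(1,2)] by (simp add: sq defs)
  have sin1: "X * Y * sin (kvangle K x y) = sqrt (X\<^sup>2 * Y\<^sup>2 - s\<^sup>2)"
    using sin_kvangle [OF K tangent(1,2)] by (simp only: sq) (simp add: defs)
  have "X * N * sin (kvangle K x n) = sqrt (X\<^sup>2 * N\<^sup>2 - t\<^sup>2)"
    using sin_kvangle [OF K tangent(1,3)] by (simp only: sq) (simp add: defs)
  \<comment> \<open>Here the sign of \<open>d\<close> matters: the root of its square is
    \<open>d\<close> itself.\<close>
  then have sin2: "X * N * sin (kvangle K x n) = d * sqrt (X\<^sup>2 * Y\<^sup>2 - s\<^sup>2)"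
    using d by (simp add: gram real_sqrt_mult)
  have cos: "X * Y * cos (kvangle K x y) = s" "X * N * cos (kvangle K x n) = t"
    using cos_kvangle [OF K tangent(1,2)] cos_kvangle [OF K tangent(1,3)] pos
    by (auto simp: defs)
  have "X\<^sup>2 * (Y * N * cos (kvangle K x y - kvangle K x n)) =
      (X * Y * cos (kvangle K x y)) * (X * N * cos (kvangle K x n)) +
      (X * Y * sin (kvangle K x y)) * (X * N * sin (kvangle K x n))"
    by (simp add: cos_diff algebra_simps power2_eq_square)
  also have "\<dots> = s * t + d * (X\<^sup>2 * Y\<^sup>2 - s\<^sup>2)"
    using cs by (simp add: cos sin1 sin2)
  also have "\<dots> = X\<^sup>2 * r"
    by (simp add: t r algebra_simps power2_eq_square)
  finally have "Y * N * cos (kvangle K x y - kvangle K x n) = r"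
    using pos by simp
  then have "cos (kvangle K x y - kvangle K x n) = r / (Y * N)"
    using pos by (simp add: field_simps)
  then show ?thesis
    by (simp only: defs)
qed

section \<open>Projections away from the plane spanned by two points\<close>

text \<open>Both sides are \<open>K\<close> times the Gram determinant of \<open>P\<close>,
  \<open>Q\<close>, \<open>Y\<close>, which is symmetric in the three points.\<close>

lemma kform_gram_kdir:
  assumes "K \<noteq> 0" "P \<in> kspace K" "Q \<in> kspace K" "Y \<in> kspace K"
  shows "kform K (kdir K Y P) (kdir K Y P) * kform K (kdir K Y Q) (kdir K Y Q)
      - (kform K (kdir K Y P) (kdir K Y Q))\<^sup>2 =
    kform K (kdir K Q P) (kdir K Q P) * kform K (kdir K Q Y) (kdir K Q Y)
      - (kform K (kdir K Q P) (kdir K Q Y))\<^sup>2"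
  using assms
  by (simp add: kform_kdir_kdir kspace_kform_self kform_commute field_simps power2_eq_square)

text \<open>Taking \<open>kdir\<close> at \<open>Q\<close> kills \<open>Q\<close>, and
  \<open>kperp\<close> then kills the direction of \<open>P\<close>: the composition is the
  projection along \<open>span {P, Q}\<close>.\<close>

lemma kperp_kdir_linear_comb:
  assumes "K \<noteq> 0" "Q \<in> kspace K" "kform K u u \<noteq> 0" "u = kdir K Q P"
  shows "kperp K u (kdir K Q (r *\<^sub>R P + s *\<^sub>R Q + V)) = kperp K u (kdir K Q V)"
proof -
  have dir: "kdir K Q (r *\<^sub>R P + s *\<^sub>R Q + V) = r *\<^sub>R u + kdir K Q V"
    using assms(1,2) unfolding assms(4)
    by (simp add: kdir_def kform_linear kspace_kform_self algebra_simps)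
  show ?thesis
    unfolding dir using assms(3)
    by (simp add: kperp_def kform_linear add_divide_distrib scaleR_add_left)
qed

lemma kperp_kdir_linear_comb2:
  assumes "K \<noteq> 0"
  shows "kperp K u (kdir K Q (c *\<^sub>R V + d *\<^sub>R W)) =
    c *\<^sub>R kperp K u (kdir K Q V) + d *\<^sub>R kperp K u (kdir K Q W)"
  using assms
  by (simp add: kdir_def kperp_def kform_linear add_divide_distrib diff_divide_distrib algebra_simps)

text \<open>It follows that the perpendicular component of a point outside
  \<open>span {P, Q}\<close> does not vanish.\<close>

lemma kperp_kdir_in_span:
  assumes "u = kdir K Q P"
  shows "X - kperp K u (kdir K Q X) \<in> span {P, Q}"
proof -
  have "X - kperp K u (kdir K Q X) =
      (if K = 0 then 1 else K * kform K Q X) *\<^sub>R Q + (kform K (kdir K Q X) u / kform K u u) *\<^sub>R u"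
    by (simp add: kperp_def kdir_def [of K Q X])
  moreover have "u \<in> span {P, Q}"
    unfolding assms kdir_def by (intro span_diff span_scale span_base) auto
  ultimately show ?thesis
    by (auto intro: span_add span_scale span_base)
qed

lemma in_span_pairE:
  fixes x y z :: "'a :: real_vector"
  assumes "x \<in> span {y, z}"
  obtains r s where "x = r *\<^sub>R y + s *\<^sub>R z"
  using assms by (auto simp: span_insert span_singleton algebra_simps)

section \<open>Signed length on a line and the foot of the perpendicular\<close>

lemma kdir_linear_comb:
  assumes "K \<noteq> 0" "Q \<in> kspace K"
  shows "kdir K Q (r *\<^sub>R P + s *\<^sub>R Q) = r *\<^sub>R kdir K Q P"
  using assms by (simp add: kdir_def kform_linear kspace_kform_self algebra_simps)

lemma cos_kolen:
  assumes "K \<noteq> 0" "F \<in> kspace K" "Q \<in> kspace K"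
  shows "cos (csqrt (of_real K) * of_real (kolen K P Q F)) = of_real (K * kform K F Q)"
  using cos_kdist [OF assms] by (auto simp: kolen_def)

text \<open>For \<open>F = r *\<^sub>R P + s *\<^sub>R Q\<close> the direction from \<open>Q\<close>
  to \<open>F\<close> is \<open>r\<close> times that to \<open>P\<close>, so the sign in
  \<open>kolen\<close> is the sign of \<open>r\<close>. This makes the sine linear in
  \<open>F\<close>.\<close>

lemma sin_kolen:
  assumes K: "K \<noteq> 0" and F: "F \<in> kline K P Q" and Q: "Q \<in> kspace K"
    and u: "kdir K Q P \<noteq> 0"
  shows "sin (csqrt (of_real K) * of_real (kolen K P Q F)) =
    csqrt (of_real K) * of_real (kform K (kdir K Q P) F / knorm K (kdir K Q P))"
proof -
  obtain r s where rs: "F = r *\<^sub>R P + s *\<^sub>R Q" and Fk: "F \<in> kspace K"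
    using F unfolding kline_def by (auto elim: in_span_pairE)
  let ?u = "kdir K Q P"
  have f: "kdir K Q F = r *\<^sub>R ?u"
    unfolding rs by (rule kdir_linear_comb [OF K Q])
  have uQ: "kform K ?u Q = 0"
    using K Q by simp
  have uu: "kform K ?u ?u > 0"
    using kform_pos_tangent [OF K Q uQ u] .
  have "kform K ?u F = kform K ?u (kdir K Q F)"
    using uQ by (simp add: kdir_def kform_linear)
  then have uF: "kform K ?u F = r * kform K ?u ?u"
    by (simp add: f kform_linear)
  \<comment> \<open>The norm sees only the absolute value of \<open>r\<close>; the case distinction
    in \<open>kolen\<close> restores the sign.\<close>
  have "knorm K (kdir K Q F) = \<bar>r\<bar> * knorm K ?u"
    by (simp add: f knorm_def kform_linear real_sqrt_mult flip: mult.assoc)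
  then have nf: "knorm K (kdir K F Q) = \<bar>r\<bar> * knorm K ?u"
    using knorm_kdir_commute [OF K Fk Q] by simp
  have div: "kform K ?u F / knorm K ?u = r * knorm K ?u"
    using uu by (simp add: uF knorm_def real_div_sqrt flip: times_divide_eq_right)
  show ?thesis
    unfolding div using uu sin_kdist [OF K Fk Q]
    by (auto simp: kolen_def f kform_linear zero_le_mult_iff nf)
qed

text \<open>The foot condition is tested at \<open>Z = P\<close> and \<open>Z = Q\<close>. Since
  \<open>kdir K F Y\<close> is orthogonal to \<open>F\<close>, orthogonality to
  \<open>kdir K F Z\<close> is orthogonality to \<open>Z\<close>.\<close>

lemma kfoot_normal:
  assumes K: "K \<noteq> 0" and P: "P \<in> kspace K" and Q: "Q \<in> kspace K"
    and foot: "is_kfoot K P Q Y F"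
  shows "kform K (kdir K F Y) F = 0" "kform K (kdir K F Y) P = 0" "kform K (kdir K F Y) Q = 0"
proof -
  have F: "F \<in> kspace K"
    using foot by (simp add: is_kfoot_def kline_def)
  show 0: "kform K (kdir K F Y) F = 0"
    using K F by simp
  have "P \<in> kline K P Q" "Q \<in> kline K P Q"
    using P Q by (auto simp: kline_def span_base)
  then have "kform K (kdir K F Y) (kdir K F P) = 0" "kform K (kdir K F Y) (kdir K F Q) = 0"
    using foot by (auto simp: is_kfoot_def)
  then show "kform K (kdir K F Y) P = 0" "kform K (kdir K F Y) Q = 0"
    using 0 by (simp_all add: kdir_def [of K F P] kdir_def [of K F Q] kform_linear)
qed

text \<open>The vector at \<open>Q\<close> that enters the dihedral angle is the very vector at
  \<open>F\<close> whose length gives the height: \<open>Y\<close> differs from it by a multiple of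
  \<open>F\<close>, which lies in \<open>span {P, Q}\<close>.\<close>

lemma kperp_kfoot:
  assumes K: "K \<noteq> 0" and P: "P \<in> kspace K" and Q: "Q \<in> kspace K"
    and foot: "is_kfoot K P Q Y F" and u: "kdir K Q P \<noteq> 0"
  shows "kperp K (kdir K Q P) (kdir K Q Y) = kdir K F Y"
proof -
  let ?u = "kdir K Q P" and ?g = "kdir K F Y"
  have uu: "kform K ?u ?u \<noteq> 0"
    using kform_pos_tangent [OF K Q _ u] K Q by simp
  have "F \<in> span {P, Q}"
    using foot by (simp add: is_kfoot_def kline_def)
  then obtain r s where rs: "F = r *\<^sub>R P + s *\<^sub>R Q"
    by (rule in_span_pairE)
  let ?m = "K * kform K F Y"
  have "Y = ?m *\<^sub>R F + ?g"
    using K by (simp add: kdir_def)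
  then have Y: "Y = (?m * r) *\<^sub>R P + (?m * s) *\<^sub>R Q + ?g"
    by (simp add: rs scaleR_add_right)
  have "kperp K ?u (kdir K Q Y) = kperp K ?u (kdir K Q ?g)"
    by (subst Y) (rule kperp_kdir_linear_comb [OF K Q uu refl])
  also have "kdir K Q ?g = ?g"
    using kfoot_normal [OF K P Q foot] K by (simp add: kdir_def [of K Q ?g] kform_commute)
  also have "kperp K ?u ?g = ?g"
    using kfoot_normal [OF K P Q foot] K
    by (simp add: kperp_def kdir_def [of K Q P] kform_linear)
  finally show ?thesis .
qed

section \<open>The cosine formula, the height and the right triangle at the foot\<close>

text \<open>The three summands are the contributions of \<open>Q\<close>, of the direction from
  \<open>Q\<close> to \<open>P\<close>, and of the orthogonal complement. Only the cosine of
  \<open>\<theta>\<close> is prescribed, so that \<open>\<theta>\<close> may be a dihedral angle as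
  well as a difference of two.\<close>

lemma kcosine_formula:
  assumes K: "K \<noteq> 0"
    and P: "P \<in> kspace K" and Q: "Q \<in> kspace K" and X: "X \<in> kspace K" and Y: "Y \<in> kspace K"
    and foot: "is_kfoot K P Q Y F" and u: "kdir K Q P \<noteq> 0"
    and px: "kperp K (kdir K Q P) (kdir K Q X) \<noteq> 0"
    and py: "kperp K (kdir K Q P) (kdir K Q Y) \<noteq> 0"
    and cos_\<theta>: "cos \<theta> =
      kform K (kperp K (kdir K Q P) (kdir K Q X)) (kperp K (kdir K Q P) (kdir K Q Y)) /
      (knorm K (kperp K (kdir K Q P) (kdir K Q X)) * knorm K (kperp K (kdir K Q P) (kdir K Q Y)))"
  defines "\<kappa> \<equiv> csqrt (of_real K)"
  shows "cos (\<kappa> * of_real (kdist K Y X)) =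
      cos (\<kappa> * of_real (kdist K Y Q)) * cos (\<kappa> * of_real (kdist K Q X))
    + sin (\<kappa> * of_real (kdist K Q X)) * cos (\<kappa> * of_real (kdist K Y F))
        * of_real (cos (kangle K P Q X)) * sin (\<kappa> * of_real (kolen K P Q F))
    + sin (\<kappa> * of_real (kdist K Q X)) * sin (\<kappa> * of_real (kdist K Y F))
        * of_real (sin (kangle K P Q X)) * of_real (cos \<theta>)"
proof -
  have Fl: "F \<in> kline K P Q" and F: "F \<in> kspace K"
    using foot by (auto simp: is_kfoot_def kline_def)
  define u' x y where dirs: "u' = kdir K Q P" "x = kdir K Q X" "y = kdir K Q Y"
  define g px' where perps: "g = kdir K F Y" "px' = kperp K u' x"
  have tang: "kform K u' Q = 0" "kform K x Q = 0" "kform K y Q = 0"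
    using K Q by (auto simp: dirs)
  have uu: "kform K u' u' > 0"
    using kform_pos_tangent [OF K Q tang(1)] u by (simp add: dirs)
  have py': "kperp K u' y = g"
    unfolding dirs perps using kperp_kfoot [OF K P Q foot u] .
  have g: "g \<noteq> 0" and px0: "px' \<noteq> 0"
    using px py py' by (auto simp: dirs perps)
  have gQ: "kform K g Q = 0"
    using kfoot_normal [OF K P Q foot] by (simp add: perps)
  have pxQ: "kform K px' Q = 0"
    using tang by (simp add: perps kperp_def kform_linear)
  have x0: "x \<noteq> 0"
    using px0 by (auto simp: perps kperp_def)
  have norms: "knorm K g > 0" "knorm K px' > 0" "knorm K x > 0" "knorm K u' > 0"
    using knorm_pos [OF K Q] g px0 x0 gQ pxQ tang uu by (auto simp: knorm_def)
  have cosX: "knorm K x * cos (kangle K P Q X) = kform K u' x / knorm K u'"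
    using cos_kvangle [OF K Q tang(1,2)] norms by (simp add: kangle_def flip: dirs)
  have u0: "u' \<noteq> 0"
    using u by (simp add: dirs)
  have sinX: "knorm K x * sin (kangle K P Q X) = knorm K px'"
    using sin_kvangle_kperp [OF K Q tang(1,2) u0] by (simp add: kangle_def perps flip: dirs)
  have cos_\<theta>': "knorm K px' * knorm K g * cos \<theta> = kform K px' g"
    using cos_\<theta> norms by (simp add: py' flip: dirs perps)
  have "kform K g u' = 0"
    using kfoot_normal [OF K P Q foot] by (simp add: dirs perps kform_linear kdir_def [of K Q P])
  then have "kform K u' g = 0"
    by (simp add: kform_commute)
  moreover have "Y = (K * kform K F Y) *\<^sub>R F + g"
    using K by (simp add: perps kdir_def)
  ultimately have "kform K u' Y = K * kform K F Y * kform K u' F"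
    by (metis kform_add_right kform_scale_right add.right_neutral)
  \<comment> \<open>The component of \<open>Y\<close> along the edge is that of the foot, scaled by
    the cosine of the height.\<close>
  then have uy: "kform K u' y = K * kform K Y F * kform K u' F"
    using tang by (simp add: dirs(3) kdir_def kform_linear kform_commute)
  have nu: "knorm K u' * knorm K u' = kform K u' u'"
    using uu by (simp add: knorm_def)
  have "kform K Y X = K * kform K Y Q * kform K Q X + kform K y x"
    using kform_kdir_kdir [OF K Q, of Y X] by (simp add: dirs kform_commute)
  also have "kform K y x = kform K u' x * kform K u' y / kform K u' u' + kform K px' g"
    using kform_kperp_kperp [of K u' x y] uu by (simp add: perps(2) py' kform_commute)
  also have "kform K u' x * kform K u' y / kform K u' u' =
      (kform K u' x / knorm K u') * (K * kform K Y F) * (kform K u' F / knorm K u')"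
    by (simp add: uy flip: nu)
  also have "\<dots> = knorm K x * (K * kform K Y F) * cos (kangle K P Q X) * (kform K u' F / knorm K u')"
    unfolding cosX [symmetric] by (simp add: mult_ac)
  also have "kform K px' g = knorm K x * knorm K g * sin (kangle K P Q X) * cos \<theta>"
    by (simp flip: cos_\<theta>' sinX)
  finally have "K * kform K Y X = (K * kform K Y Q) * (K * kform K Q X)
      + K * (knorm K x * (K * kform K Y F) * cos (kangle K P Q X) * (kform K u' F / knorm K u'))
      + K * (knorm K x * knorm K g * sin (kangle K P Q X) * cos \<theta>)"
    by (simp add: algebra_simps)
  \<comment> \<open>Each factor \<open>K\<close> is written as the square of
    \<open>\<kappa>\<close>, one \<open>\<kappa>\<close> for each of the two sines in the summand
    that depend on a length.\<close>
  then have "of_real (K * kform K Y X) = (of_real (K * kform K Y Q) * of_real (K * kform K Q X)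
      + \<kappa>\<^sup>2 * of_real (knorm K x * (K * kform K Y F) * cos (kangle K P Q X) * (kform K u' F / knorm K u'))
      + \<kappa>\<^sup>2 * of_real (knorm K x * knorm K g * sin (kangle K P Q X) * cos \<theta>) :: complex)"
    unfolding \<kappa>_def power2_csqrt by (simp only: of_real_add of_real_mult)
  moreover have "knorm K (kdir K Y F) = knorm K g"
    using knorm_kdir_commute [OF K Y F] by (simp add: perps)
  ultimately show ?thesis
    unfolding \<kappa>_def cos_kdist [OF K Y X] cos_kdist [OF K Y Q] cos_kdist [OF K Q X]
      cos_kdist [OF K Y F] sin_kdist [OF K Q X] sin_kdist [OF K Y F] sin_kolen [OF K Fl Q u]
    unfolding \<kappa>_def [symmetric] dirs [symmetric]
    by (simp only: of_real_mult power2_eq_square mult_ac)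
qed

text \<open>The Gram determinant of the triangle is computed twice: from the angle at
  \<open>Y\<close> and its two adjacent sides, and from base and height.\<close>

lemma sin_kheight:
  assumes K: "K \<noteq> 0"
    and P: "P \<in> kspace K" and Q: "Q \<in> kspace K" and Y: "Y \<in> kspace K"
    and foot: "is_kfoot K P Q Y F"
    and u: "kdir K Q P \<noteq> 0" and p: "kdir K Y P \<noteq> 0" and q: "kdir K Y Q \<noteq> 0"
  defines "\<kappa> \<equiv> csqrt (of_real K)"
  shows "sin (\<kappa> * of_real (kdist K Y F)) =
      sin (\<kappa> * of_real (kdist K Y P)) * sin (\<kappa> * of_real (kdist K Y Q)) / sin (\<kappa> * of_real (kdist K P Q))
    * csqrt (1 - ((cos (\<kappa> * of_real (kdist K P Q))
                  - cos (\<kappa> * of_real (kdist K Y P)) * cos (\<kappa> * of_real (kdist K Y Q)))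
               / (sin (\<kappa> * of_real (kdist K Y P)) * sin (\<kappa> * of_real (kdist K Y Q))))\<^sup>2)"
proof -
  have F: "F \<in> kspace K"
    using foot by (auto simp: is_kfoot_def kline_def)
  define u' p' q' y where dirs: "u' = kdir K Q P" "p' = kdir K Y P" "q' = kdir K Y Q" "y = kdir K Q Y"
  have tang: "kform K u' Q = 0" "kform K p' Y = 0" "kform K q' Y = 0" "kform K y Q = 0"
    using K Q Y by (auto simp: dirs)
  have u0: "u' \<noteq> 0"
    using u by (simp add: dirs)
  have norms: "knorm K u' > 0" "knorm K p' > 0" "knorm K q' > 0"
    using knorm_pos [OF K Q tang(1)] knorm_pos [OF K Y tang(2)] knorm_pos [OF K Y tang(3)] u p q
    by (auto simp: dirs)
  have \<kappa>2: "\<kappa>\<^sup>2 = of_real K" and \<kappa>0: "\<kappa> \<noteq> 0"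
    using K by (auto simp: \<kappa>_def)
  define c where "c = kform K p' q' / (knorm K p' * knorm K q')"
  have c: "c = cos (kvangle K p' q')"
    unfolding c_def using cos_kvangle [OF K Y tang(2,3)] by simp
  have c1: "\<bar>c\<bar> \<le> 1"
    unfolding c by (rule abs_cos_le_one)
  have "kvangle K p' q' = arccos c"
    by (simp add: kvangle_def c_def knorm_def)
  then have sc: "sqrt (1 - c\<^sup>2) = sin (kvangle K p' q')"
    using sin_arccos_abs [OF c1] by simp
  have "knorm K p' * knorm K q' * sqrt (1 - c\<^sup>2) = knorm K u' * knorm K y * sin (kvangle K u' y)"
    unfolding sc sin_kvangle [OF K Y tang(2,3)] sin_kvangle [OF K Q tang(1,4)]
    by (simp add: dirs kform_gram_kdir [OF K P Q Y])
  also have "\<dots> = knorm K u' * knorm K (kdir K Y F)"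
    using sin_kvangle_kperp [OF K Q tang(1,4) u0] kperp_kfoot [OF K P Q foot u]
      knorm_kdir_commute [OF K Y F] by (simp add: dirs)
  finally have main: "knorm K (kdir K Y F) = knorm K p' * knorm K q' / knorm K u' * sqrt (1 - c\<^sup>2)"
    using norms by (simp add: field_simps)
  have "of_real (K * kform K P Q) - of_real (K * kform K Y P) * of_real (K * kform K Y Q) =
      \<kappa>\<^sup>2 * of_real (kform K p' q')"
    unfolding \<kappa>2 dirs kform_kdir_kdir [OF K Y] by (simp add: algebra_simps)
  \<comment> \<open>By the law of cosines the quotient is the cosine \<open>c\<close> of the angle
    at \<open>Y\<close>. It is real with modulus at most 1, so \<open>csqrt\<close> becomes a real
    root.\<close>
  then have ratio: "(of_real (K * kform K P Q) - of_real (K * kform K Y P) * of_real (K * kform K Y Q))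
      / ((\<kappa> * of_real (knorm K p')) * (\<kappa> * of_real (knorm K q'))) = of_real c"
    using \<kappa>0 by (simp add: c_def power2_eq_square)
  have "csqrt (1 - (of_real c)\<^sup>2) = csqrt (of_real (1 - c\<^sup>2))"
    by simp
  also have "\<dots> = of_real (sqrt (1 - c\<^sup>2))"
    using c1 by (intro csqrt_of_real) (simp add: abs_square_le_1)
  finally have "csqrt (1 - (of_real c)\<^sup>2) = of_real (sqrt (1 - c\<^sup>2))" .
  moreover have "knorm K (kdir K P Q) = knorm K u'"
    using knorm_kdir_commute [OF K P Q] by (simp add: dirs)
  ultimately show ?thesis
    unfolding \<kappa>_def sin_kdist [OF K Y F] sin_kdist [OF K Y P] sin_kdist [OF K Y Q] sin_kdist [OF K P Q]
      cos_kdist [OF K P Q] cos_kdist [OF K Y P] cos_kdist [OF K Y Q]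
    unfolding \<kappa>_def [symmetric] dirs [symmetric] ratio
    using \<kappa>0 by (simp add: main)
qed

text \<open>Pythagoras in the right triangle with vertices \<open>Y\<close>, \<open>F\<close>,
  \<open>Q\<close>: \<open>kdir K F Y\<close> is orthogonal to \<open>Q\<close>.\<close>

lemma cos_kdist_kfoot:
  assumes K: "K \<noteq> 0" and P: "P \<in> kspace K" and Q: "Q \<in> kspace K" and Y: "Y \<in> kspace K"
    and foot: "is_kfoot K P Q Y F"
  defines "\<kappa> \<equiv> csqrt (of_real K)"
  shows "cos (\<kappa> * of_real (kdist K Y Q)) =
    cos (\<kappa> * of_real (kdist K Y F)) * cos (\<kappa> * of_real (kolen K P Q F))"
proof -
  have F: "F \<in> kspace K"
    using foot by (auto simp: is_kfoot_def kline_def)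
  have "kform K (kdir K F Y) Q = 0"
    using kfoot_normal [OF K P Q foot] by simp
  then have "kform K Y Q = K * kform K Y F * kform K F Q"
    using K by (simp add: kdir_def kform_linear kform_commute)
  then show ?thesis
    unfolding \<kappa>_def cos_kdist [OF K Y Q] cos_kdist [OF K Y F] cos_kolen [OF K F Q]
    by simp
qed

section \<open>Linear independence of the vertices\<close>

text \<open>Independence concerns the set of vertices; injectivity carries the coefficients over
  from the indices.\<close>

lemma ktetrahedron_scalars_zero:
  assumes "ktetrahedron K A" "(\<Sum>i\<in>{1..4}. c i *\<^sub>R A i) = 0" "i \<in> {1..4}"
  shows "c i = 0"
proof -
  have inj: "inj_on A {1..4}" and ind: "independent (A ` {1..4})"
    using assms by (auto simp: ktetrahedron_def)
  have "(\<Sum>v\<in>A ` {1..4}. c (the_inv_into {1..4} A v) *\<^sub>R v) = 0"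
    unfolding sum.reindex [OF inj] o_def assms(2) [symmetric]
    by (intro sum.cong refl) (simp only: the_inv_into_f_f [OF inj])
  then have "c (the_inv_into {1..4} A (A i)) = 0"
    using independentD [OF ind, of "A ` {1..4}" "\<lambda>v. c (the_inv_into {1..4} A v)" "A i"] assms(3)
    by auto
  then show ?thesis
    using the_inv_into_f_f [OF inj assms(3)] by simp
qed

text \<open>Subtracting multiples of \<open>A i\<close> and \<open>A j\<close> leaves the nonzero
  coefficient at \<open>m\<close> unchanged. The case \<open>i = j\<close> is allowed and covers
  multiples of a single vertex.\<close>

lemma ktetrahedron_not_in_span:
  assumes T: "ktetrahedron K A"
    and ij: "i \<in> {1..4}" "j \<in> {1..4}" "m \<in> {1..4}" "m \<noteq> i" "m \<noteq> j" "c m \<noteq> 0"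
  shows "(\<Sum>k\<in>{1..4}. c k *\<^sub>R A k) \<notin> span {A i, A j}"
proof
  assume "(\<Sum>k\<in>{1..4}. c k *\<^sub>R A k) \<in> span {A i, A j}"
  then obtain r s where "(\<Sum>k\<in>{1..4}. c k *\<^sub>R A k) = r *\<^sub>R A i + s *\<^sub>R A j"
    by (rule in_span_pairE)
  then have rs: "(\<Sum>k\<in>{1..4}. c k *\<^sub>R A k) - r *\<^sub>R A i - s *\<^sub>R A j = 0"
    by simp
  have delta: "(\<Sum>k\<in>{1..4}. (if k = n then t else 0) *\<^sub>R A k) = t *\<^sub>R A n"
    if "n \<in> {1..4}" for n t
    using that by (simp add: if_distrib [of "\<lambda>x. x *\<^sub>R _"] sum.delta cong: if_cong)
  have "(\<Sum>k\<in>{1..4}. (c k - (if k = i then r else 0) - (if k = j then s else 0)) *\<^sub>R A k) = 0"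
    using rs by (simp only: scaleR_diff_left sum_subtractf delta [OF ij(1)] delta [OF ij(2)])
  from ktetrahedron_scalars_zero [OF T this ij(3)] show False
    using ij by simp
qed

theorem theorem18:
  fixes K :: real
    and A :: "nat \<Rightarrow> kpoint"
    and B :: "nat \<Rightarrow> real"
    and F :: kpoint
    and \<kappa> :: complex
    and a :: "nat \<Rightarrow> nat \<Rightarrow> real"
    and ang :: "nat \<Rightarrow> nat \<Rightarrow> nat \<Rightarrow> real"
    and \<alpha> \<alpha>g4 h l :: real
  defines "\<kappa> \<equiv> csqrt (of_real K)"
    and "a \<equiv> \<lambda>i j. kdist K (A i) (A j)"
    and "ang \<equiv> \<lambda>i j k. kangle K (A i) (A j) (A k)"
    and "\<alpha> \<equiv> kdihedral K (A 1) (A 2) (A 3) (A 0)"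
    and "\<alpha>g4 \<equiv> kdihedral K (A 1) (A 2) (A 3) (A 4)"
    and "h \<equiv> kdist K (A 0) F"
    and "l \<equiv> kolen K (A 1) (A 2) F"
  assumes tetrahedron: "ktetrahedron K A"
    and weights: "\<forall>i\<in>{1..4}. B i > 0"
    and fermat: "is_weighted_Fermat_point K A B (A 0)"
    and inside: "A 0 \<in> kinside K A"
    and foot: "is_kfoot K (A 1) (A 2) (A 0) F"
  shows "cos (\<kappa> * of_real (a 0 3)) =
           cos (\<kappa> * of_real (a 0 2)) * cos (\<kappa> * of_real (a 2 3))
         + sin (\<kappa> * of_real (a 2 3)) * cos (\<kappa> * of_real h)
             * of_real (cos (ang 1 2 3)) * sin (\<kappa> * of_real l)
         + sin (\<kappa> * of_real (a 2 3)) * sin (\<kappa> * of_real h)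
             * of_real (sin (ang 1 2 3)) * of_real (cos \<alpha>)
       \<and> cos (\<kappa> * of_real (a 0 4)) =
           cos (\<kappa> * of_real (a 0 2)) * cos (\<kappa> * of_real (a 2 4))
         + sin (\<kappa> * of_real (a 2 4)) * cos (\<kappa> * of_real h)
             * of_real (cos (ang 1 2 4)) * sin (\<kappa> * of_real l)
         + sin (\<kappa> * of_real (a 2 4)) * sin (\<kappa> * of_real h)
             * of_real (sin (ang 1 2 4)) * of_real (cos (\<alpha>g4 - \<alpha>))
       \<and> (K \<noteq> 0 \<longrightarrow>
         sin (\<kappa> * of_real h) =
           sin (\<kappa> * of_real (a 0 1)) * sin (\<kappa> * of_real (a 0 2)) / sin (\<kappa> * of_real (a 1 2))
         * csqrt (1 - ((cos (\<kappa> * of_real (a 1 2))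
                        - cos (\<kappa> * of_real (a 0 1)) * cos (\<kappa> * of_real (a 0 2)))
                     / (sin (\<kappa> * of_real (a 0 1)) * sin (\<kappa> * of_real (a 0 2))))\<^sup>2))
       \<and> (cos (\<kappa> * of_real h) \<noteq> 0 \<longrightarrow>
         cos (\<kappa> * of_real l) = cos (\<kappa> * of_real (a 0 2)) / cos (\<kappa> * of_real h))"
proof (cases "K = 0")
  case True
  then show ?thesis
    by (simp add: \<kappa>_def)
next
  case K: False
  have As: "A 1 \<in> kspace K" "A 2 \<in> kspace K" "A 3 \<in> kspace K" "A 4 \<in> kspace K"
    using tetrahedron by (auto simp: ktetrahedron_def)
  obtain c where c: "\<forall>i\<in>{1..4}. 0 < c i" "A 0 = (\<Sum>i\<in>{1..4}. c i *\<^sub>R A i)"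
    and A0: "A 0 \<in> kspace K"
    using inside by (auto simp: kinside_def)
  have sum4: "(\<Sum>i\<in>{1..4}. f i) = f 1 + f 2 + f 3 + f 4" for f :: "nat \<Rightarrow> kpoint"
    by (simp add: numeral_eq_Suc atLeastAtMostSuc_conv add_ac)
  have single: "(\<Sum>i\<in>{1..4}. (if i = n then 1 else 0) *\<^sub>R A i) = A n" if "n \<in> {1..4}" for n
    using that by (simp add: if_distrib [of "\<lambda>x. x *\<^sub>R _"] sum.delta cong: if_cong)
  have out0: "A 0 \<notin> span {A i, A j}" if "i \<in> {1..4}" "j \<in> {1..4}" for i j
  proof -
    obtain m where "m \<in> {1..4::nat}" "m \<noteq> i" "m \<noteq> j"
      by (metis (full_types) atLeastAtMost_iff le_refl numeral_le_iff one_le_numeral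
          semiring_norm(68,69,71) num.distinct(1) numeral_eq_iff numeral_eq_one_iff)
    then show ?thesis
      using ktetrahedron_not_in_span [OF tetrahedron that, of m c] c by force
  qed
  have out: "A n \<notin> span {A i, A j}"
    if "n \<in> {1..4}" "i \<in> {1..4}" "j \<in> {1..4}" "n \<noteq> i" "n \<noteq> j" for n i j
    using ktetrahedron_not_in_span [OF tetrahedron that(2,3,1,4,5), of "\<lambda>i. if i = n then 1 else 0"]
      single [OF that(1)] by simp
  \<comment> \<open>The doubled \<open>Y\<close> lets \<open>out\<close> and \<open>out0\<close>
    apply with equal indices.\<close>
  have dir0: "kdir K Y X \<noteq> 0" if "X \<notin> span {Y, Y}" for X Y
  proof
    assume "kdir K Y X = 0"
    then have "X = (if K = 0 then 1 else K * kform K Y X) *\<^sub>R Y"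
      by (simp add: kdir_def)
    then show False
      using that by (metis insertI1 span_base span_scale)
  qed
  have u: "kdir K (A 2) (A 1) \<noteq> 0" and p: "kdir K (A 1) (A 0) \<noteq> 0" and q: "kdir K (A 2) (A 0) \<noteq> 0"
    by (rule dir0, rule out out0; simp)+
  \<comment> \<open>\<open>out0\<close> gives directions based at vertices; the symmetry of the
    length transfers nonvanishing to directions based at \<open>A 0\<close>.\<close>
  have p': "kdir K (A 0) (A 1) \<noteq> 0" and q': "kdir K (A 0) (A 2) \<noteq> 0"
    using knorm_kdir_commute [OF K As(1) A0] knorm_kdir_commute [OF K As(2) A0]
      knorm_pos [OF K As(1) _ p] knorm_pos [OF K As(2) _ q] K As
    by (auto simp: knorm_def [of K 0])
  define u' where "u' = kdir K (A 2) (A 1)"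
  define g where "g X = kperp K u' (kdir K (A 2) X)" for X
  have g0: "g X \<noteq> 0" if "X \<notin> span {A 1, A 2}" for X
    using kperp_kdir_in_span [OF u'_def, of X] that by (auto simp: g_def)
  have gs: "g (A 0) \<noteq> 0" "g (A 3) \<noteq> 0" "g (A 4) \<noteq> 0"
    by (rule g0, rule out out0; simp)+
  have uQ: "kform K u' (A 2) = 0"
    using K As by (simp add: u'_def)
  have uu: "kform K u' u' \<noteq> 0"
    using kform_pos_tangent [OF K As(2) uQ] u by (simp add: u'_def)
  have gQ: "kform K (g X) (A 2) = 0" for X
    using K As uQ by (simp add: g_def kperp_def kform_linear)
  \<comment> \<open>The projection removes \<open>A 1\<close> and \<open>A 2\<close>, leaving the
    barycentric weights of \<open>A 3\<close> and \<open>A 4\<close>.\<close>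
  have "g (A 0) = g (c 1 *\<^sub>R A 1 + c 2 *\<^sub>R A 2 + (c 3 *\<^sub>R A 3 + c 4 *\<^sub>R A 4))"
    by (simp only: c(2) sum4 add.assoc)
  then have comb: "g (A 0) = c 3 *\<^sub>R g (A 3) + c 4 *\<^sub>R g (A 4)"
    unfolding g_def kperp_kdir_linear_comb [OF K As(2) uu u'_def]
    by (simp add: kperp_kdir_linear_comb2 [OF K])
  have \<alpha>: "\<alpha> = kvangle K (g (A 3)) (g (A 0))" and \<alpha>g4: "\<alpha>g4 = kvangle K (g (A 3)) (g (A 4))"
    by (simp_all add: \<alpha>_def \<alpha>g4_def kdihedral_def g_def u'_def)
  have cos3: "cos \<alpha> = kform K (g (A 3)) (g (A 0)) / (knorm K (g (A 3)) * knorm K (g (A 0)))"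
    unfolding \<alpha> using cos_kvangle [OF K As(2) gQ gQ] .
  \<comment> \<open>Positivity of \<open>c 4\<close> puts \<open>A 0\<close> on the same side of the
    plane of \<open>A 1\<close>, \<open>A 2\<close>, \<open>A 3\<close> as \<open>A 4\<close>, so
    the dihedral angles subtract.\<close>
  have cos4: "cos (\<alpha>g4 - \<alpha>) = kform K (g (A 4)) (g (A 0)) / (knorm K (g (A 4)) * knorm K (g (A 0)))"
    unfolding \<alpha> \<alpha>g4
    by (rule cos_kvangle_diff [OF K As(2) gQ gQ comb _ gs(2,3,1)]) (use c(1) in \<open>simp add: less_imp_le\<close>)
  note dirs = g_def u'_def
  show ?thesis
    unfolding a_def ang_def h_def l_def \<kappa>_def
    using kcosine_formula [OF K As(1,2,3) A0 foot u gs(2,1) [unfolded dirs] cos3 [unfolded dirs]]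
      kcosine_formula [OF K As(1,2,4) A0 foot u gs(3,1) [unfolded dirs] cos4 [unfolded dirs]]
      sin_kheight [OF K As(1,2) A0 foot u p' q']
      cos_kdist_kfoot [OF K As(1,2) A0 foot]
    by simp
qed

end
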